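(* Let $h$ be a dimension function, let $N\in\mathbb{N}$, and let $\mathcal{F}$ be a family of continuous functions from $\mathbb{R}^N$ to $\mathbb{R}^N$. Suppose there exists a countable family $\Psi=\{\psi_j:\Omega_j\to\mathbb{R}^N\}_j$ of injective, closed, continuous functions defined on closed sets $\Omega_j\subseteq\mathbb{R}^N$ such that, for every $j$, the inverse $\psi_j^{-1}:\mathrm{Im}(\psi_j)\to\Omega_j$ is locally bilipschitz and $$\lim_{\|x\|\to+\infty,\ x\in\mathrm{Im}(\psi_j)}\|\psi_j^{-1}(x)\|=+\infty .$$ Suppose moreover that to each $f\in\mathcal{F}$ there are assigned an index $r(f)$ and a closed set $D_f\subseteq\mathbb{R}^N$ such that: (i) for each $f\in\mathcal{F}$, the composition $\psi_{r(f)}\circ f|_{D_f}$ is well defined (i.e. $f(D_f)\subseteq\Omega_{r(f)}$) and is non-expansive bilipschitz; (ii) for each $a>0$ and any finitely many functions $f_1,\dots,f_n\in\mathcal{F}$, the set $$A_{a,f_1,\dots,f_n}:=\bigcap_{1\le i\le n}\bigl(\psi_{r(f_i)}\circ f_i|_{D_{f_i}}\bigr)^{-1}\Bigl(\bigl(\mathbb{R}\setminus(-a,a)\bigr)^N\Bigr)$$ contains arbitrarily large balls. Then there exists a perfect set $E\subseteq\mathbb{R}^N$ such that $\mathcal{H}^h(E)=0$ and $\bigcap_{1\le i\le n}f_i^{-1}(E)\neq\emptyset$ for each finite subset $\{f_1,\dots,f_n\}\subseteq\mathcal{F}$.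
   Context: A dimension function is a function $h:\mathbb{R}_{\ge0}\to\mathbb{R}\cup\{+\infty\}$ that is non-decreasing and right continuous, with $h(0)=0$ and $h(t)>0$ for $t>0$. The associated (outer) Hausdorff measure is $\mathcal{H}^h(E)=\lim_{\delta\to0}\inf\{\sum_i h(|U_i|):\{U_i\}_i\text{ a (countable) }\delta\text{-covering of }E\}$, where $|U|$ is the diameter of $U$ and a $\delta$-covering is a covering by sets of diameter at most $\delta$. A map $g:X\to\mathbb{R}^N$, $X\subseteq\mathbb{R}^N$, is bilipschitz with constants $(c_1,c_2)$, $c_1,c_2>0$, if $c_1\|x-y\|\le\|g(x)-g(y)\|\le c_2\|x-y\|$ for all $x,y\in X$; it is non-expansive bilipschitz if this holds with some $c_2\le1$. A map $\psi:\Omega\to\mathbb{R}^N$, $\Omega\subseteq\mathbb{R}^N$, is locally bilipschitz if for every $x_0\in\Omega$ there are $\varepsilon>0$ and $c_1,c_2>0$ (depending on $x_0$) such that $c_1\|x-y\|\le\|\psi(x)-\psi(y)\|\le c_2\|x-y\|$ for all $x,y\in B(x_0,\varepsilon)\cap\Omega$. A map is closed if it sends closed subsets of its domain to closed subsets of its codomain. A set contains arbitrarily large balls if for every $\rho>0$ it contains a ball of $\mathbb{R}^N$ of radius $\rho$. A perfect set is a closed set without isolated points. *)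

theory Defs
  imports "HOL-Analysis.Analysis"
begin

text \<open>A dimension function is a function on the nonnegative reals; it is represented by a total
  function on \<^typ>\<open>real\<close> whose values at negative arguments are unconstrained and never used.\<close>

definition dimension_function :: "(real \<Rightarrow> ereal) \<Rightarrow> bool" where
  "dimension_function h \<longleftrightarrow>
     (\<forall>t\<ge>0. h t \<noteq> -\<infinity>) \<and>
     mono_on {0..} h \<and>
     (\<forall>t\<ge>0. continuous (at_right t) h) \<and>
     h 0 = 0 \<and>
     (\<forall>t>0. h t > 0)"

text \<open>Countable coverings are sequences of sets; a finite covering is padded with empty sets, which
  cost nothing since \<^term>\<open>h 0 = 0\<close> and \<^term>\<open>diameter {} = 0\<close>. Boundedness is required
  explicitly because \<^const>\<open>diameter\<close> is real-valued and meaningless on unbounded sets.\<close>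

definition delta_covering :: "real \<Rightarrow> 'a::metric_space set \<Rightarrow> (nat \<Rightarrow> 'a set) \<Rightarrow> bool" where
  "delta_covering \<delta> E U \<longleftrightarrow>
     E \<subseteq> (\<Union>i. U i) \<and> (\<forall>i. bounded (U i) \<and> diameter (U i) \<le> \<delta>)"

definition hausdorff_premeasure :: "(real \<Rightarrow> ereal) \<Rightarrow> real \<Rightarrow> 'a::metric_space set \<Rightarrow> ereal" where
  "hausdorff_premeasure h \<delta> E = Inf {(\<Sum>i. h (diameter (U i))) | U. delta_covering \<delta> E U}"

definition hausdorff_measure :: "(real \<Rightarrow> ereal) \<Rightarrow> 'a::metric_space set \<Rightarrow> ereal" where
  "hausdorff_measure h E = Lim (at_right 0) (\<lambda>\<delta>. hausdorff_premeasure h \<delta> E)"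

text \<open>The limit always exists, so \<^const>\<open>Lim\<close> is not used outside its domain.\<close>

lemma hausdorff_premeasure_antimono:
  assumes "\<delta> \<le> \<delta>'"
  shows "hausdorff_premeasure h \<delta>' E \<le> hausdorff_premeasure h \<delta> E"
  unfolding hausdorff_premeasure_def
proof (rule Inf_superset_mono)
  have "delta_covering \<delta>' E U" if "delta_covering \<delta> E U" for U
    using that assms unfolding delta_covering_def by (meson order.trans)
  then show "{(\<Sum>i. h (diameter (U i))) | U. delta_covering \<delta> E U}
      \<subseteq> {(\<Sum>i. h (diameter (U i))) | U. delta_covering \<delta>' E U}"
    by blast
qed

lemma hausdorff_premeasure_tendsto:
  "((\<lambda>\<delta>. hausdorff_premeasure h \<delta> E) \<longlongrightarrow> (SUP \<delta>\<in>{0<..}. hausdorff_premeasure h \<delta> E)) (at_right 0)"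
proof (rule order_tendstoI)
  fix a assume "a < (SUP \<delta>\<in>{0<..}. hausdorff_premeasure h \<delta> E)"
  then obtain d where d: "d > 0" "a < hausdorff_premeasure h d E"
    by (auto simp: less_SUP_iff)
  have "a < hausdorff_premeasure h \<delta> E" if "\<delta> < d" for \<delta>
    by (rule order.strict_trans2[OF d(2) hausdorff_premeasure_antimono]) (use that in simp)
  then show "\<forall>\<^sub>F \<delta> in at_right 0. a < hausdorff_premeasure h \<delta> E"
    unfolding eventually_at_right_field using d(1) by blast
next
  fix a assume a: "(SUP \<delta>\<in>{0<..}. hausdorff_premeasure h \<delta> E) < a"
  have "hausdorff_premeasure h \<delta> E < a" if "\<delta> > 0" for \<delta>
    using a that by (meson SUP_upper greaterThan_iff order.strict_trans1)
  then show "\<forall>\<^sub>F \<delta> in at_right 0. hausdorff_premeasure h \<delta> E < a"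
    unfolding eventually_at_right_field using zero_less_one by blast
qed

lemma hausdorff_measure_eq_SUP:
  "hausdorff_measure h E = (SUP \<delta>\<in>{0<..}. hausdorff_premeasure h \<delta> E)"
  unfolding hausdorff_measure_def
  by (rule tendsto_Lim[OF _ hausdorff_premeasure_tendsto]) simp

definition bilipschitz_on ::
    "real \<Rightarrow> real \<Rightarrow> 'a::metric_space set \<Rightarrow> ('a \<Rightarrow> 'b::metric_space) \<Rightarrow> bool" where
  "bilipschitz_on c1 c2 X g \<longleftrightarrow>
     c1 > 0 \<and> c2 > 0 \<and>
     (\<forall>x\<in>X. \<forall>y\<in>X. c1 * dist x y \<le> dist (g x) (g y) \<and> dist (g x) (g y) \<le> c2 * dist x y)"

definition nonexpansive_bilipschitz_on ::
    "'a::metric_space set \<Rightarrow> ('a \<Rightarrow> 'b::metric_space) \<Rightarrow> bool" where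
  "nonexpansive_bilipschitz_on X g \<longleftrightarrow> (\<exists>c1 c2. bilipschitz_on c1 c2 X g \<and> c2 \<le> 1)"

definition locally_bilipschitz_on ::
    "'a::metric_space set \<Rightarrow> ('a \<Rightarrow> 'b::metric_space) \<Rightarrow> bool" where
  "locally_bilipschitz_on X g \<longleftrightarrow>
     (\<forall>x0\<in>X. \<exists>\<epsilon>>0. \<exists>c1 c2. bilipschitz_on c1 c2 (ball x0 \<epsilon> \<inter> X) g)"

definition contains_arbitrarily_large_balls :: "'a::metric_space set \<Rightarrow> bool" where
  "contains_arbitrarily_large_balls A \<longleftrightarrow> (\<forall>\<rho>>0. \<exists>x. ball x \<rho> \<subseteq> A)"

definition perfect_set :: "'a::topological_space set \<Rightarrow> bool" where
  "perfect_set E \<longleftrightarrow> closed E \<and> (\<forall>x\<in>E. \<not> x isolated_in E)"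

end

theory Submission
  imports Defs
begin

text \<open>Choose scales \<open>\<delta> t\<close> decreasing extremely fast, and finite nets \<open>P t\<close> of the ball of radius
  \<open>t + 1\<close> whose mesh is \<open>\<delta> (t - 1) / (2 (t + 1))\<close>. The times \<open>t\<close> are divided into infinitely many
  infinite classes, and the layer of index \<open>i\<close> consists of the points that at every time of class \<open>i\<close>
  lie within \<open>\<delta> t\<close> of \<open>P t\<close> (or have norm at least \<open>t\<close>). Since \<open>\<delta> t\<close> is chosen after \<open>P t\<close>, layers
  are null for the Hausdorff measure, even after a locally Lipschitz change of variable. Given finitely
  many non-expansive bilipschitz maps, assign them distinct layers with large indices. At each time only
  one layer imposes a constraint, and by invariance of domain the image of the current ball under
  the corresponding map contains a net point, around which the next ball is chosen; the nested balls
  shrink to a point whose images lie in all the assigned layers.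

  The set is the union of the preimages of the layers under the \<open>\<psi> j\<close>, each cut off near the origin so
  that the union is locally finite, hence closed. The cut-off is harmless because the hypothesis on
  the sets \<open>A\<close> allows the construction to start far from the origin. Finally, adding a sufficiently thin
  Cantor set removes isolated points.\<close>

section \<open>Sets of Hausdorff measure zero and their countable unions\<close>

text \<open>The infimum and the limit in the measure are unfolded into explicit coverings, so that
  unions can be treated by choosing and merging coverings. For a dimension function this gives
  measure zero.\<close>

definition hausdorff_null :: "(real \<Rightarrow> ereal) \<Rightarrow> 'a::metric_space set \<Rightarrow> bool" where
  "hausdorff_null h A \<longleftrightarrow>
     (\<forall>d>0. \<forall>e>0. \<exists>U. delta_covering d A U \<and> (\<Sum>i. h (diameter (U i))) \<le> ereal e)"

lemma hausdorff_nullD: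
  assumes "hausdorff_null h A" "d > 0" "e > 0"
  obtains U where "delta_covering d A U" "(\<Sum>i. h (diameter (U i))) \<le> ereal e"
  using assms unfolding hausdorff_null_def by blast

lemma dimension_function_nonneg:
  assumes "dimension_function h" "t \<ge> 0"
  shows "h t \<ge> 0"
  using assms unfolding dimension_function_def by (metis le_less)

lemma dimension_function_mono:
  assumes "dimension_function h" "0 \<le> s" "s \<le> t"
  shows "h s \<le> h t"
  using assms unfolding dimension_function_def mono_on_def by auto

lemma dimension_function_small:
  assumes "dimension_function h" "e > 0"
  obtains d where "d > 0" "\<And>t. 0 \<le> t \<Longrightarrow> t \<le> d \<Longrightarrow> h t \<le> ereal e"
proof -
  have "(h \<longlongrightarrow> h 0) (at_right 0)" and h0: "h 0 = 0"
    using assms unfolding dimension_function_def continuous_within by auto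
  then have "\<forall>\<^sub>F t in at_right 0. h t < ereal e"
    using assms(2) by (intro order_tendstoD) (auto simp: zero_ereal_def)
  then obtain b where "b > 0" "\<And>t. 0 < t \<Longrightarrow> t < b \<Longrightarrow> h t < ereal e"
    unfolding eventually_at_right_field by blast
  then show thesis
    using that[of "b/2"] h0 assms(2)
    by (metis dual_order.strict_trans1 ereal_less(2) field_sum_of_halves half_gt_zero_iff le_less
        less_add_same_cancel2)
qed

lemma hausdorff_measure_null:
  assumes "dimension_function h" "hausdorff_null h A"
  shows "hausdorff_measure h A = 0"
proof -
  have "hausdorff_premeasure h d A = 0" if "d > 0" for d
  proof (rule antisym)
    show "hausdorff_premeasure h d A \<le> 0"
    proof (rule ereal_le_epsilon2)
      fix e :: real assume "e > 0"
      with assms(2) that obtain U where "delta_covering d A U" "(\<Sum>i. h (diameter (U i))) \<le> ereal e"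
        by (rule hausdorff_nullD)
      then show "hausdorff_premeasure h d A \<le> 0 + ereal e"
        unfolding hausdorff_premeasure_def by (auto intro: Inf_lower2)
    qed
    show "0 \<le> hausdorff_premeasure h d A"
      unfolding hausdorff_premeasure_def
      by (auto intro!: Inf_greatest suminf_0_le dimension_function_nonneg[OF assms(1)]
          diameter_ge_0 simp: delta_covering_def)
  qed
  then have "hausdorff_measure h A = (SUP \<delta>\<in>{0::real<..}. 0)"
    unfolding hausdorff_measure_eq_SUP by (intro SUP_cong) auto
  then show ?thesis
    by simp
qed

lemma hausdorff_null_mono:
  assumes "hausdorff_null h B" "A \<subseteq> B"
  shows "hausdorff_null h A"
  using assms unfolding hausdorff_null_def delta_covering_def by (meson order.trans)

text \<open>The \<open>n\<close>-th set is covered at cost \<open>e * (1/2) ^ Suc n\<close>, and the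
  coverings are merged into one sequence by the pairing function.\<close>

lemma hausdorff_null_UN_nat:
  fixes A :: "nat \<Rightarrow> 'a::metric_space set"
  assumes h: "dimension_function h" and A: "\<And>n. hausdorff_null h (A n)"
  shows "hausdorff_null h (\<Union>n. A n)"
  unfolding hausdorff_null_def
proof safe
  fix d e :: real assume "d > 0" "e > 0"
  have "\<exists>U. delta_covering d (A n) U \<and> (\<Sum>i. h (diameter (U i))) \<le> ereal (e * (1/2) ^ Suc n)" for n
    using A[of n] \<open>d > 0\<close> \<open>e > 0\<close> unfolding hausdorff_null_def by simp
  then obtain U where U: "\<And>n. delta_covering d (A n) (U n)"
    and sumU: "\<And>n. (\<Sum>i. h (diameter (U n i))) \<le> ereal (e * (1/2) ^ Suc n)"
    by metis
  define V where "V = (\<lambda>k. case prod_decode k of (n, i) \<Rightarrow> U n i)"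
  have nonneg: "0 \<le> h (diameter (U n i))" for n i
    using U by (auto intro!: dimension_function_nonneg[OF h] diameter_ge_0 simp: delta_covering_def)
  have "(\<Union>n. A n) \<subseteq> (\<Union>k. V k)"
  proof safe
    fix x n assume "x \<in> A n"
    then obtain i where "x \<in> U n i"
      using U[of n] unfolding delta_covering_def by blast
    then have "x \<in> V (prod_encode (n, i))"
      by (simp add: V_def)
    then show "x \<in> (\<Union>k. V k)" by blast
  qed
  then have "delta_covering d (\<Union>n. A n) V"
    using U unfolding delta_covering_def V_def by (auto split: prod.split)
  moreover have "(\<Sum>k. h (diameter (V k))) \<le> ereal e"
  proof (rule suminf_bound, intro allI)
    fix N :: nat
    \<comment> \<open>A pair code is at least as large as both components, so the first
      \<open>N\<close> codes lie in a finite square. Bounding partial sums this way avoids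
      rearranging a double series.\<close>
    have box: "prod_decode ` {..<N} \<subseteq> {..<N} \<times> {..<N}"
    proof safe
      fix k a b assume "k < N" "(a, b) = prod_decode k"
      then have "prod_encode (a, b) < N" by simp
      then show "a < N" "b < N"
        using le_prod_encode_1[of a b] le_prod_encode_2[of b a] by linarith+
    qed
    have "(\<Sum>k<N. h (diameter (V k))) = (\<Sum>(n, i)\<in>prod_decode ` {..<N}. h (diameter (U n i)))"
      by (subst sum.reindex) (auto simp: V_def inj_prod_decode split: prod.split intro!: sum.cong)
    also have "\<dots> \<le> (\<Sum>(n, i)\<in>{..<N} \<times> {..<N}. h (diameter (U n i)))"
      using box nonneg by (intro sum_mono2) auto
    also have "\<dots> = (\<Sum>n<N. \<Sum>i<N. h (diameter (U n i)))"
      by (simp add: sum.cartesian_product)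
    also have "\<dots> \<le> (\<Sum>n<N. ereal (e * (1/2) ^ Suc n))"
      by (intro sum_mono order.trans[OF suminf_upper sumU] nonneg)
    also have "\<dots> = ereal (e * (\<Sum>n<N. (1/2) ^ Suc n))"
      by (simp add: sum_distrib_left)
    also have "\<dots> \<le> ereal e"
    proof -
      have "(\<Sum>n<N. (1/2::real) ^ Suc n) \<le> 1"
        using sum_le_suminf[OF sums_summable[OF power_half_series], of "{..<N}"]
          sums_unique[OF power_half_series] by simp
      then show ?thesis
        using \<open>e > 0\<close> by simp
    qed
    finally show "(\<Sum>k<N. h (diameter (V k))) \<le> ereal e" .
  next
    show "0 \<le> h (diameter (V k))" for k
      using nonneg by (simp add: V_def split: prod.split)
  qed
  ultimately show "\<exists>U. delta_covering d (\<Union>n. A n) U \<and> (\<Sum>i. h (diameter (U i))) \<le> ereal e"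
    by blast
qed

lemma hausdorff_null_empty:
  assumes "dimension_function h"
  shows "hausdorff_null h {}"
  unfolding hausdorff_null_def
proof safe
  fix d e :: real assume "d > 0" "e > 0"
  then show "\<exists>U. delta_covering d {} U \<and> (\<Sum>i. h (diameter (U i))) \<le> ereal e"
    using assms by (intro exI[of _ "\<lambda>_. {}"]) (auto simp: delta_covering_def dimension_function_def)
qed

lemma hausdorff_null_UN:
  fixes A :: "'i \<Rightarrow> 'a::metric_space set"
  assumes "dimension_function h" "countable I" "\<And>i. i \<in> I \<Longrightarrow> hausdorff_null h (A i)"
  shows "hausdorff_null h (\<Union>i\<in>I. A i)"
proof (cases "I = {}")
  case True
  then show ?thesis using hausdorff_null_empty[OF assms(1)] by simp
next
  case False
  then have "(\<Union>i\<in>I. A i) = (\<Union>n. A (from_nat_into I n))"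
    using assms(2) by (metis image_image range_from_nat_into)
  then show ?thesis
    using assms(1,3) False by (simp add: hausdorff_null_UN_nat from_nat_into)
qed

text \<open>Padding with empty sets costs nothing because \<open>h 0 = 0\<close>, and monotonicity
  of \<open>h\<close> bounds each of the other terms by \<open>h d\<close>.\<close>

lemma finite_covering_sequence:
  fixes V :: "'i \<Rightarrow> 'a::metric_space set"
  assumes h: "dimension_function h" and "finite I" and cov: "A \<subseteq> (\<Union>i\<in>I. V i)"
    and V: "\<And>i. i \<in> I \<Longrightarrow> bounded (V i) \<and> diameter (V i) \<le> d" and "d \<ge> 0"
    and cost: "ereal (real (card I)) * h d \<le> ereal e"
  obtains U where "delta_covering d A U" "(\<Sum>i. h (diameter (U i))) \<le> ereal e"
proof -
  obtain b where b: "bij_betw b {..<card I} I"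
    using ex_bij_betw_nat_finite[OF \<open>finite I\<close>] by (auto simp: lessThan_atLeast0)
  define U where "U = (\<lambda>n. if n < card I then V (b n) else {})"
  have "A \<subseteq> (\<Union>n. U n)"
  proof
    fix x assume "x \<in> A"
    then obtain i where "i \<in> I" "x \<in> V i" using cov by blast
    moreover then obtain n where "n < card I" "b n = i"
      using b by (metis bij_betw_iff_bijections lessThan_iff)
    ultimately have "x \<in> U n" by (simp add: U_def)
    then show "x \<in> (\<Union>n. U n)" by blast
  qed
  moreover have "bounded (U n) \<and> diameter (U n) \<le> d" for n
    using V b \<open>d \<ge> 0\<close> by (auto simp: U_def bij_betw_apply)
  ultimately have U: "delta_covering d A U"
    by (simp add: delta_covering_def)
  have "(\<Sum>n. h (diameter (U n))) = (\<Sum>n<card I. h (diameter (U n)))"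
    using h by (intro suminf_finite) (auto simp: U_def dimension_function_def)
  also have "\<dots> \<le> (\<Sum>n<card I. h d)"
    using U by (intro sum_mono dimension_function_mono[OF h])
      (auto simp: delta_covering_def diameter_ge_0)
  also have "\<dots> = ereal (real (card I)) * h d"
    by (simp add: sum_constant_ereal mult.commute)
  finally show thesis
    using that U cost by (meson order.trans)
qed

section \<open>Two topological tools: locally finite unions and quantitative openness\<close>

text \<open>The open ball of radius \<open>m\<close> can meet only the first \<open>m\<close> sets,
  so the union is locally finite.\<close>

lemma closed_UN_escaping:
  fixes A :: "nat \<Rightarrow> 'a::real_normed_vector set"
  assumes closed: "\<And>n. closed (A n)" and far: "\<And>n z. z \<in> A n \<Longrightarrow> real n \<le> norm z"
  shows "closed (\<Union>n. A n)"
proof -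
  have "\<exists>T. open T \<and> x \<in> T \<and> T \<subseteq> - (\<Union>n. A n)" if x: "x \<notin> (\<Union>n. A n)" for x
  proof -
    obtain m where m: "norm x < real m" using reals_Archimedean2 by blast
    have "open (ball 0 (real m) - (\<Union>n<m. A n))"
      using closed by (intro open_Diff closed_UN) auto
    moreover have "ball 0 (real m) - (\<Union>n<m. A n) \<subseteq> - (\<Union>n. A n)"
      using far by (force simp: not_less)
    ultimately show ?thesis
      using x m by (intro exI[of _ "ball 0 (real m) - (\<Union>n<m. A n)"]) auto
  qed
  then have "open (- (\<Union>n. A n))"
    by (subst open_subopen) blast
  then show ?thesis
    by (simp add: closed_def)
qed

text \<open>By invariance of domain the image of the open ball is open, so its frontier lies in the
  image of the sphere, at distance at least \<open>c1 * \<rho>\<close> from \<open>g x\<close>. The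
  connected ball around \<open>g x\<close> meets the image but not its frontier, hence lies inside
  it.\<close>

lemma bilipschitz_image_ball:
  fixes g :: "'a::euclidean_space \<Rightarrow> 'a"
  assumes g: "bilipschitz_on c1 c2 (cball x \<rho>) g" and "\<rho> > 0"
  shows "ball (g x) (c1 * \<rho>) \<subseteq> g ` ball x \<rho>"
proof (rule ccontr)
  assume not_sub: "\<not> ?thesis"
  have c: "c1 > 0" "c2 > 0"
    and lo: "\<And>y z. y \<in> cball x \<rho> \<Longrightarrow> z \<in> cball x \<rho> \<Longrightarrow> c1 * dist y z \<le> dist (g y) (g z)"
    and up: "\<And>y z. y \<in> cball x \<rho> \<Longrightarrow> z \<in> cball x \<rho> \<Longrightarrow> dist (g y) (g z) \<le> c2 * dist y z"
    using g unfolding bilipschitz_on_def by auto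
  have cont: "continuous_on (cball x \<rho>) g"
    by (rule lipschitz_on_continuous_on[of c2]) (use c up in \<open>auto intro: lipschitz_onI\<close>)
  have "inj_on g (cball x \<rho>)"
    using lo c by (intro inj_onI) (fastforce simp: mult_le_0_iff)
  then have op: "open (g ` ball x \<rho>)"
    using cont by (intro invariance_of_domain)
      (auto intro: continuous_on_subset inj_on_subset)
  have "compact (g ` cball x \<rho>)"
    using cont by (simp add: compact_continuous_image)
  then have "closure (g ` ball x \<rho>) \<subseteq> g ` cball x \<rho>"
    by (intro closure_minimal) (auto simp: compact_imp_closed)
  moreover have "g ` cball x \<rho> - g ` ball x \<rho> \<subseteq> g ` sphere x \<rho>"
    by (force simp: dist_commute)
  ultimately have "frontier (g ` ball x \<rho>) \<subseteq> g ` sphere x \<rho>"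
    using op by (auto simp: frontier_def interior_open)
  moreover have "ball (g x) (c1 * \<rho>) \<inter> g ` sphere x \<rho> = {}"
    using lo[of x] \<open>\<rho> > 0\<close> by force
  moreover have "ball (g x) (c1 * \<rho>) \<inter> g ` ball x \<rho> \<noteq> {}"
    using \<open>\<rho> > 0\<close> c by (metis IntI centre_in_ball empty_iff imageI mult_pos_pos)
  ultimately show False
    using connected_Int_frontier[of "ball (g x) (c1 * \<rho>)" "g ` ball x \<rho>"] not_sub by auto
qed

section \<open>Scales, nets and layers; the nested balls\<close>

text \<open>In \<open>net\<close>, the mesh is half of \<open>\<delta> t\<close> times
  \<open>1 / (real t + 2)\<close>, a lower Lipschitz constant that eventually falls below any given
  one. In \<open>cost\<close>, the growing factor \<open>2 * (real t + 1)\<close> absorbs any fixed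
  Lipschitz constant.\<close>

locale covering_scales =
  fixes h :: "real \<Rightarrow> ereal" and P :: "nat \<Rightarrow> 'a::euclidean_space set" and \<delta> :: "nat \<Rightarrow> real"
  assumes h: "dimension_function h"
    and finite_P: "finite (P t)"
    and \<delta>_pos: "\<delta> t > 0"
    and \<delta>_0: "\<delta> 0 \<le> 1"
    and \<delta>_Suc: "\<delta> (Suc t) \<le> \<delta> t / 2"
    and net: "norm y \<le> real t + 2 \<Longrightarrow> \<exists>p\<in>P (Suc t). dist y p < \<delta> t / (2 * (real t + 2))"
    and \<delta>_small: "2 * (real t + 1) * \<delta> t \<le> 1 / (real t + 1)"
    and cost: "ereal (real (card (P t) * 2 ^ t)) * h (2 * (real t + 1) * \<delta> t) \<le> ereal (1 / (real t + 1))"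
begin

text \<open>The class of the time \<open>t\<close> is \<open>fst (prod_decode t)\<close>: each time
  has exactly one class, and each class is infinite.\<close>

definition layer :: "nat \<Rightarrow> 'a set" where
  "layer i = {y. \<forall>t. fst (prod_decode t) = i \<longrightarrow> real t \<le> norm y \<or> (\<exists>p\<in>P t. dist p y \<le> \<delta> t)}"

lemma closed_layer: "closed (layer i)"
proof -
  have "layer i = (\<Inter>t\<in>{t. fst (prod_decode t) = i}. {y. real t \<le> norm y} \<union> (\<Union>p\<in>P t. cball p (\<delta> t)))"
    by (auto simp: layer_def)
  moreover have "closed {y::'a. real t \<le> norm y}" for t
    by (intro closed_Collect_le continuous_intros)
  ultimately show ?thesis
    by (auto intro!: closed_INT closed_Un closed_UN finite_P)
qed

lemma \<delta>_decseq: "s \<le> t \<Longrightarrow> \<delta> t \<le> \<delta> s"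
proof (rule lift_Suc_antimono_le)
  show "\<delta> (Suc n) \<le> \<delta> n" for n
    using \<delta>_Suc[of n] \<delta>_pos[of n] by simp
qed

lemma \<delta>_tendsto_0: "\<eta> > 0 \<Longrightarrow> \<exists>t\<ge>m. \<delta> t < \<eta>"
proof -
  assume "\<eta> > 0"
  have "\<delta> t \<le> (1/2) ^ t" for t
  proof (induction t)
    case 0
    show ?case using \<delta>_0 by simp
  next
    case (Suc t)
    then show ?case using \<delta>_Suc[of t] by simp
  qed
  moreover obtain n where "(1/2::real) ^ n < \<eta>"
    using \<open>\<eta> > 0\<close> real_arch_pow_inv[of \<eta> "1/2"] by auto
  ultimately have "\<delta> n < \<eta>"
    by (meson le_less_trans)
  then show ?thesis
    by (intro exI[of _ "max m n"]) (use \<delta>_decseq[of n "max m n"] in auto)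
qed

text \<open>Injectivity of \<open>idx\<close> means that each time constrains at most one map, so
  the constraints can be met one after another. Since \<open>t0 < idx f\<close>, no relevant
  constraint occurs up to the starting time.\<close>

lemma common_point_in_layers:
  fixes g :: "'f \<Rightarrow> 'a \<Rightarrow> 'a"
  assumes inj: "inj_on idx G" and idx: "\<And>f. f \<in> G \<Longrightarrow> t0 < idx f"
    and g: "\<And>f. f \<in> G \<Longrightarrow> bilipschitz_on (1 / (real t0 + 2)) 1 (cball x0 1) (g f)"
  shows "\<exists>x\<in>cball x0 1. \<forall>f\<in>G. g f x \<in> layer (idx f)"
proof -
  define target where "target t = {y::'a. real t \<le> norm y \<or> (\<exists>p\<in>P t. dist p y \<le> \<delta> t)}" for t
  have step: "\<exists>x'. cball x' (\<delta> (Suc t)) \<subseteq> cball x (\<delta> t) \<and>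
      (\<forall>f\<in>G. idx f = fst (prod_decode (Suc t)) \<longrightarrow> g f ` cball x' (\<delta> (Suc t)) \<subseteq> target (Suc t))"
    if t: "t0 \<le> t" and x: "cball x (\<delta> t) \<subseteq> cball x0 1" for t x
  proof (cases "\<exists>f\<in>G. idx f = fst (prod_decode (Suc t))")
    case False
    have "cball x (\<delta> (Suc t)) \<subseteq> cball x (\<delta> t)"
      using \<delta>_decseq[of t "Suc t"] by (intro subset_cball) simp
    with False show ?thesis by blast
  next
    case True
    then obtain f where f: "f \<in> G" "idx f = fst (prod_decode (Suc t))" by blast
    have only: "f' = f" if "f' \<in> G" "idx f' = fst (prod_decode (Suc t))" for f'
      using inj f that by (metis inj_onD)
    have lip: "dist (g f y) (g f z) \<le> dist y z" if "y \<in> cball x (\<delta> t)" "z \<in> cball x (\<delta> t)" for y z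
      using g[OF f(1)] that x unfolding bilipschitz_on_def by (metis mult_1 subsetD)
    have xin: "x \<in> cball x (\<delta> t)"
      using \<delta>_pos[of t] by simp
    have \<delta>1: "\<delta> (Suc t) \<le> 1" "\<delta> (Suc t) \<le> \<delta> t / 2"
      using \<delta>_0 \<delta>_decseq[of 0 "Suc t"] \<delta>_Suc[of t] by auto
    have "\<exists>x'. cball x' (\<delta> (Suc t)) \<subseteq> cball x (\<delta> t) \<and> g f ` cball x' (\<delta> (Suc t)) \<subseteq> target (Suc t)"
    proof (cases "norm (g f x) \<le> real t + 2")
      \<comment> \<open>The map does not increase distances and the next ball has radius at most 1,
        so the image of that ball stays beyond radius \<open>t + 1\<close>, where time
        \<open>Suc t\<close> imposes nothing. The centre need not move.\<close>
      case far: False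
      have sub: "cball x (\<delta> (Suc t)) \<subseteq> cball x (\<delta> t)"
        using \<delta>_decseq[of t "Suc t"] by (intro subset_cball) simp
      have "g f z \<in> target (Suc t)" if "z \<in> cball x (\<delta> (Suc t))" for z
      proof -
        have "dist (g f x) (g f z) \<le> 1"
          using lip[OF xin, of z] that sub \<delta>1 by fastforce
        then have "norm (g f x) \<le> norm (g f z) + 1"
          using norm_triangle_sub[of "g f x" "g f z"] by (simp add: dist_norm)
        then show ?thesis
          using far by (simp add: target_def)
      qed
      with sub show ?thesis by blast
    next
      case True
      then obtain p where p: "p \<in> P (Suc t)" "dist (g f x) p < \<delta> t / (2 * (real t + 2))"
        using net by blast
      \<comment> \<open>The mesh is at most the lower Lipschitz constant times half the radius, so a
        net point has a preimage in the half ball. The other half leaves room for the next ball,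
        since \<open>\<delta>\<close> at least halves.\<close>
      have "\<delta> t / (2 * (real t + 2)) \<le> 1 / (real t0 + 2) * (\<delta> t / 2)"
        using t \<delta>_pos[of t] by (simp add: field_simps)
      then have near: "p \<in> ball (g f x) (1 / (real t0 + 2) * (\<delta> t / 2))"
        using p by simp
      have bil: "bilipschitz_on (1 / (real t0 + 2)) 1 (cball x (\<delta> t / 2)) (g f)"
      proof -
        have "cball x (\<delta> t / 2) \<subseteq> cball x0 1"
          using \<delta>_pos[of t] by (intro order.trans[OF subset_cball x]) simp
        then show ?thesis
          using g[OF f(1)] unfolding bilipschitz_on_def by blast
      qed
      have "p \<in> g f ` ball x (\<delta> t / 2)"
        by (rule subsetD[OF bilipschitz_image_ball[OF bil] near]) (simp add: \<delta>_pos)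
      then obtain x' where x': "x' \<in> ball x (\<delta> t / 2)" "g f x' = p"
        by blast
      have sub: "cball x' (\<delta> (Suc t)) \<subseteq> cball x (\<delta> t)"
      proof
        fix z assume "z \<in> cball x' (\<delta> (Suc t))"
        then show "z \<in> cball x (\<delta> t)"
          using x' \<delta>1 dist_triangle[of x z x'] by simp
      qed
      have "g f z \<in> target (Suc t)" if z: "z \<in> cball x' (\<delta> (Suc t))" for z
      proof -
        have "x' \<in> cball x (\<delta> t)" "z \<in> cball x (\<delta> t)"
          using sub z x'(1) \<delta>_pos[of t] by (simp, blast)
        then have "dist p (g f z) \<le> \<delta> (Suc t)"
          using lip[of x' z] x' z by simp
        then show ?thesis
          using p(1) by (auto simp: target_def)
      qed
      with sub show ?thesis by blast
    qed
    then show ?thesis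
      using only by blast
  qed
  define nxt where "nxt t x y \<longleftrightarrow> cball y (\<delta> (Suc t)) \<subseteq> cball x (\<delta> t) \<and>
      (\<forall>f\<in>G. idx f = fst (prod_decode (Suc t)) \<longrightarrow> g f ` cball y (\<delta> (Suc t)) \<subseteq> target (Suc t))"
    for t x y
  have "\<exists>X. \<forall>n. cball (X n) (\<delta> (t0 + n)) \<subseteq> cball x0 1 \<and> nxt (t0 + n) (X n) (X (Suc n))"
  proof (rule dependent_nat_choice)
    show "\<exists>x. cball x (\<delta> (t0 + 0)) \<subseteq> cball x0 1"
      using \<delta>_0 \<delta>_decseq[of 0 t0] by (intro exI[of _ x0] subset_cball) simp
  next
    fix x n assume x: "cball x (\<delta> (t0 + n)) \<subseteq> cball x0 1"
    then obtain y where y: "nxt (t0 + n) x y"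
      using step[of "t0 + n" x] unfolding nxt_def by auto
    then have "cball y (\<delta> (t0 + Suc n)) \<subseteq> cball x (\<delta> (t0 + n))"
      by (simp add: nxt_def)
    with x y show "\<exists>y. cball y (\<delta> (t0 + Suc n)) \<subseteq> cball x0 1 \<and> nxt (t0 + n) x y"
      by blast
  qed
  then obtain X where X0: "\<And>n. cball (X n) (\<delta> (t0 + n)) \<subseteq> cball x0 1"
    and X: "\<And>n. nxt (t0 + n) (X n) (X (Suc n))"
    by blast
  have nested: "cball (X (Suc n)) (\<delta> (t0 + Suc n)) \<subseteq> cball (X n) (\<delta> (t0 + n))" for n
    using X[of n] by (simp add: nxt_def)
  have hit: "g f ` cball (X (Suc n)) (\<delta> (t0 + Suc n)) \<subseteq> target (Suc (t0 + n))"
    if "f \<in> G" "idx f = fst (prod_decode (Suc (t0 + n)))" for n f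
    using X[of n] that by (simp add: nxt_def)
  have "\<Inter>(range (\<lambda>n. cball (X n) (\<delta> (t0 + n)))) \<noteq> {}"
  proof (rule compact_nest)
    show "cball (X n) (\<delta> (t0 + n)) \<noteq> {}" for n
      using \<delta>_pos[of "t0 + n"] by simp
    show "cball (X n) (\<delta> (t0 + n)) \<subseteq> cball (X m) (\<delta> (t0 + m))" if "m \<le> n" for m n
      using nested that by (rule lift_Suc_antimono_le)
  qed auto
  then obtain x where x: "\<And>n. x \<in> cball (X n) (\<delta> (t0 + n))"
    by blast
  have "g f x \<in> layer (idx f)" if f: "f \<in> G" for f
    unfolding layer_def
  proof (intro CollectI allI impI)
    fix t assume t: "fst (prod_decode t) = idx f"
    \<comment> \<open>A time of class \<open>idx f\<close> is at least \<open>idx f\<close>, hence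
      later than \<open>t0\<close> and met by the construction.\<close>
    have "fst (prod_decode t) \<le> t"
      using le_prod_encode_1[of "fst (prod_decode t)" "snd (prod_decode t)"] by simp
    then obtain n where n: "t = Suc (t0 + n)"
      using idx[OF f] t by (metis less_iff_Suc_add less_le_trans)
    then have "idx f = fst (prod_decode (Suc (t0 + n)))"
      using t by simp
    from hit[OF f this] have "g f x \<in> target t"
      using x[of "Suc n"] unfolding n by blast
    then show "real t \<le> norm (g f x) \<or> (\<exists>p\<in>P t. dist p (g f x) \<le> \<delta> t)"
      by (simp add: target_def)
  qed
  then show ?thesis
    using x[of 0] X0[of 0] by blast
qed

section \<open>A compact perfect set of subsums, and thickening by it\<close>

text \<open>This is the set of all subsums of the series of the \<open>\<delta> t\<close>; the
  closure of the finite subsums avoids infinite sums.\<close>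

definition dust :: "real set" where
  "dust = closure {sum \<delta> S | S. finite S}"

lemma sum_\<delta>_le: "finite S \<Longrightarrow> (\<And>s. s \<in> S \<Longrightarrow> t \<le> s) \<Longrightarrow> sum \<delta> S \<le> 2 * \<delta> t"
proof -
  assume "finite S" and ge: "\<And>s. s \<in> S \<Longrightarrow> t \<le> s"
  then obtain n where "S \<subseteq> {..<n}"
    using finite_nat_iff_bounded by blast
  then have "S \<subseteq> {t..<t + n}"
    using ge by fastforce
  \<comment> \<open>The subtracted remainder makes the induction close: halving gives
    \<open>\<delta> (t + n) \<le> 2 * \<delta> (t + n) - 2 * \<delta> (t + Suc n)\<close>.\<close>
  moreover have "sum \<delta> {t..<t + n} \<le> 2 * \<delta> t - 2 * \<delta> (t + n)"
  proof (induction n)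
    case (Suc n)
    then show ?case using \<delta>_Suc[of "t + n"] by simp
  qed simp
  moreover have "sum \<delta> S \<le> sum \<delta> {t..<t + n}"
    using calculation(1) \<delta>_pos by (intro sum_mono2) (auto intro: less_imp_le)
  ultimately show ?thesis
    using \<delta>_pos[of "t + n"] by linarith
qed

text \<open>The terms before \<open>t\<close> leave \<open>2 ^ t\<close> choices, and all later
  terms add at most \<open>2 * \<delta> t\<close>. The finite union of closed intervals survives the
  closure.\<close>

lemma dust_cover: "dust \<subseteq> (\<Union>S\<in>Pow {..<t}. {sum \<delta> S..sum \<delta> S + 2 * \<delta> t})"
  unfolding dust_def
proof (rule closure_minimal)
  show "{sum \<delta> S | S. finite S} \<subseteq> (\<Union>S\<in>Pow {..<t}. {sum \<delta> S..sum \<delta> S + 2 * \<delta> t})"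
  proof safe
    fix S :: "nat set" assume S: "finite S"
    have "sum \<delta> S = sum \<delta> (S \<inter> {..<t}) + sum \<delta> (S - {..<t})"
      using S by (metis sum.Int_Diff)
    moreover have "sum \<delta> (S - {..<t}) \<le> 2 * \<delta> t"
      using S by (intro sum_\<delta>_le) auto
    moreover have "0 \<le> sum \<delta> (S - {..<t})"
      using \<delta>_pos by (intro sum_nonneg) (auto intro: less_imp_le)
    ultimately show "sum \<delta> S \<in> (\<Union>S\<in>Pow {..<t}. {sum \<delta> S..sum \<delta> S + 2 * \<delta> t})"
      by (intro UN_I[of "S \<inter> {..<t}"]) auto
  qed
qed (auto intro: closed_UN)

lemma zero_in_dust: "0 \<in> dust"
  unfolding dust_def by (rule closure_subset[THEN subsetD]) (force intro: exI[of _ "{}"])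

lemma compact_dust: "compact dust"
  unfolding compact_eq_bounded_closed
proof
  show "bounded dust"
    using dust_cover[of 0] by (auto intro: bounded_subset[OF bounded_closed_interval])
qed (simp add: dust_def)

lemma dust_no_isolated_point:
  assumes "c \<in> dust" "\<eta> > 0"
  shows "\<exists>c'\<in>dust. c' \<noteq> c \<and> dist c c' < \<eta>"
proof -
  obtain S where S: "finite S" "dist (sum \<delta> S) c < \<eta>"
    using assms unfolding dust_def closure_approachable by blast
  show ?thesis
  proof (cases "sum \<delta> S = c")
    case False
    then show ?thesis
      using S closure_subset[of "{sum \<delta> S | S. finite S}"] unfolding dust_def
      by (intro bexI[of _ "sum \<delta> S"]) (auto simp: dist_commute)
  next
    case True
    obtain m where m: "S \<subseteq> {..<m}"
      using S(1) finite_nat_iff_bounded by auto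
    obtain t where t: "m \<le> t" "\<delta> t < \<eta>"
      using \<delta>_tendsto_0[OF assms(2)] by blast
    have "t \<notin> S" using m t(1) by auto
    then have sum: "sum \<delta> (insert t S) = c + \<delta> t"
      using S(1) True by simp
    have "sum \<delta> (insert t S) \<in> dust"
      unfolding dust_def using S(1) by (intro subsetD[OF closure_subset]) blast
    then show ?thesis
      using t(2) \<delta>_pos[of t] unfolding sum by (intro bexI[of _ "c + \<delta> t"]) (auto simp: dist_real_def)
  qed
qed

text \<open>Adding the perfect compact set \<^const>\<open>dust\<close> turns a closed set into a perfect one. At scale
  \<^term>\<open>\<delta> t\<close> this multiplies the number of covering sets by \<^term>\<open>2 ^ t\<close>, which the assumption
  \<open>cost\<close> has allowed for.\<close>

definition thicken :: "'a set \<Rightarrow> 'a set" where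
  "thicken A = (\<Union>c\<in>(\<lambda>c. c *\<^sub>R (SOME b. b \<in> Basis)) ` dust. \<Union>a\<in>A. {c + a})"

lemma mem_thicken: "x \<in> thicken A \<longleftrightarrow> (\<exists>a\<in>A. \<exists>c\<in>dust. x = a + c *\<^sub>R (SOME b. b \<in> Basis))"
  by (auto simp: thicken_def add.commute)

lemma norm_dust_direction: "norm (SOME b::'a. b \<in> Basis) = 1"
  by (rule norm_Basis) (rule SOME_Basis)

lemma subset_thicken: "A \<subseteq> thicken A"
  using zero_in_dust by (force simp: mem_thicken)

lemma thicken_UN: "thicken (\<Union>i\<in>I. A i) = (\<Union>i\<in>I. thicken (A i))"
  by (simp add: thicken_def) blast

text \<open>The sum of a compact and a closed set is closed, and each point is approached within its
  own translate of the dust.\<close>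

lemma perfect_thicken:
  assumes "closed A"
  shows "perfect_set (thicken A)"
proof -
  have "closed (thicken A)"
    unfolding thicken_def
    by (intro compact_closed_sums compact_continuous_image continuous_intros compact_dust assms)
  moreover have "\<not> x isolated_in thicken A" if x: "x \<in> thicken A" for x
  proof -
    obtain a c where ac: "a \<in> A" "c \<in> dust" "x = a + c *\<^sub>R (SOME b. b \<in> Basis)"
      using x by (auto simp: mem_thicken)
    have "\<exists>y\<in>thicken A. dist x y < e \<and> y \<noteq> x" if e: "e > 0" for e
    proof -
      obtain c' where c': "c' \<in> dust" "c' \<noteq> c" "dist c c' < e"
        using dust_no_isolated_point[OF ac(2) e] by blast
      have "dist x (a + c' *\<^sub>R (SOME b. b \<in> Basis)) = dist c c'"
        using norm_dust_direction
        by (simp add: ac(3) dist_norm flip: scaleR_diff_left)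
      moreover have "a + c' *\<^sub>R (SOME b. b \<in> Basis) \<in> thicken A"
        using ac c' by (auto simp: mem_thicken)
      ultimately show ?thesis
        using c' by (metis dist_eq_0_iff)
    qed
    then show ?thesis
      unfolding isolated_in_dist_Ex_iff by blast
  qed
  ultimately show ?thesis
    by (simp add: perfect_set_def)
qed

section \<open>Nullity of thickened preimages of layers\<close>

text \<open>Arbitrarily late good times suffice. Once \<open>L \<le> t\<close>, a piece of diameter
  \<open>L * \<delta> t\<close> widened by a dust interval has diameter at most
  \<open>(t + 2) * \<delta> t\<close>, within the scale priced by \<open>cost\<close>.\<close>

lemma hausdorff_null_thicken:
  fixes A :: "'a set" and L :: real
  assumes cover: "\<And>m. \<exists>t\<ge>m. \<exists>V. A \<subseteq> (\<Union>p\<in>P t. V p) \<and>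
      (\<forall>p\<in>P t. \<forall>y\<in>V p. \<forall>z\<in>V p. dist y z \<le> L * \<delta> t)"
  shows "hausdorff_null h (thicken A)"
  unfolding hausdorff_null_def
proof safe
  fix d e :: real assume "d > 0" "e > 0"
  obtain m where m: "1 / (real m + 1) < d" "1 / (real m + 1) < e" "L \<le> real m"
  proof -
    obtain m where "max (max (1/d) (1/e)) L < real m"
      using reals_Archimedean2 by blast
    then show thesis
      using that[of m] \<open>d > 0\<close> \<open>e > 0\<close> by (simp add: field_simps)
  qed
  obtain t V where t: "m \<le> t" and V: "A \<subseteq> (\<Union>p\<in>P t. V p)"
    and diam: "\<And>p y z. p \<in> P t \<Longrightarrow> y \<in> V p \<Longrightarrow> z \<in> V p \<Longrightarrow> dist y z \<le> L * \<delta> t"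
    using cover[of m] by blast
  \<comment> \<open>One covering set for each net point and each of the \<open>2 ^ t\<close> dust
    intervals.\<close>
  define W where "W = (\<lambda>(p, S). {y + c *\<^sub>R (SOME b::'a. b \<in> Basis) | y c.
      y \<in> V p \<and> c \<in> {sum \<delta> S..sum \<delta> S + 2 * \<delta> t}})"
  define \<rho> where "\<rho> = 2 * (real t + 1) * \<delta> t"
  have \<rho>: "\<rho> \<ge> 0"
    using \<delta>_pos[of t] by (simp add: \<rho>_def)
  have W_diam: "norm (u - v) \<le> \<rho>" if pS: "pS \<in> P t \<times> Pow {..<t}" and u: "u \<in> W pS" and v: "v \<in> W pS" for pS u v
  proof -
    obtain p S y c z c' where *: "pS = (p, S)" "u = y + c *\<^sub>R (SOME b::'a. b \<in> Basis)"
      "v = z + c' *\<^sub>R (SOME b::'a. b \<in> Basis)" "y \<in> V p" "z \<in> V p"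
      "c \<in> {sum \<delta> S..sum \<delta> S + 2 * \<delta> t}" "c' \<in> {sum \<delta> S..sum \<delta> S + 2 * \<delta> t}"
      using u v by (cases pS) (auto simp: W_def)
    have "u - v = (y - z) + (c - c') *\<^sub>R (SOME b::'a. b \<in> Basis)"
      by (simp add: * algebra_simps)
    then have "norm (u - v) \<le> norm (y - z) + \<bar>c - c'\<bar>"
      using norm_dust_direction by (metis mult.right_neutral norm_scaleR norm_triangle_ineq)
    also have "\<dots> \<le> L * \<delta> t + 2 * \<delta> t"
      using * diam[of p y z] pS by (intro add_mono) (auto simp: dist_norm)
    also have "\<dots> \<le> real t * \<delta> t + 2 * \<delta> t"
      using m t \<delta>_pos[of t] by (intro add_right_mono mult_right_mono) auto
    also have "\<dots> \<le> \<rho>"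
      using \<delta>_pos[of t] by (simp add: \<rho>_def algebra_simps)
    finally show ?thesis .
  qed
  have W_cover: "thicken A \<subseteq> (\<Union>pS\<in>P t \<times> Pow {..<t}. W pS)"
  proof
    fix x assume "x \<in> thicken A"
    then obtain y c where yc: "y \<in> A" "c \<in> dust" "x = y + c *\<^sub>R (SOME b. b \<in> Basis)"
      by (auto simp: mem_thicken)
    obtain p where "p \<in> P t" "y \<in> V p"
      using V yc by blast
    moreover obtain S where "S \<in> Pow {..<t}" "c \<in> {sum \<delta> S..sum \<delta> S + 2 * \<delta> t}"
      using dust_cover yc by blast
    ultimately show "x \<in> (\<Union>pS\<in>P t \<times> Pow {..<t}. W pS)"
      using yc(3) by (intro UN_I[of "(p, S)"]) (auto simp: W_def)
  qed
  have W_small: "bounded (W pS) \<and> diameter (W pS) \<le> \<rho>" if "pS \<in> P t \<times> Pow {..<t}" for pS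
  proof
    show "bounded (W pS)"
      unfolding bounded_two_points using W_diam[OF that] by (auto simp: dist_norm)
    show "diameter (W pS) \<le> \<rho>"
      using W_diam[OF that] \<rho> by (intro diameter_le) auto
  qed
  have W_cost: "ereal (real (card (P t \<times> Pow {..<t}))) * h \<rho> \<le> ereal (1 / (real t + 1))"
    using cost[of t] by (simp add: \<rho>_def card_cartesian_product card_Pow)
  obtain U where U: "delta_covering \<rho> (thicken A) U"
    "(\<Sum>i. h (diameter (U i))) \<le> ereal (1 / (real t + 1))"
    by (rule finite_covering_sequence[OF h _ W_cover W_small \<rho> W_cost]) (simp_all add: finite_P)
  have le: "1 / (real t + 1) \<le> 1 / (real m + 1)"
    using t by (intro divide_left_mono) auto
  have "\<rho> \<le> d"
    using \<delta>_small[of t] le m by (simp add: \<rho>_def)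
  moreover have "ereal (1 / (real t + 1)) \<le> ereal e"
    using le m by simp
  ultimately show "\<exists>U. delta_covering d (thicken A) U \<and> (\<Sum>i. h (diameter (U i))) \<le> ereal e"
    using U unfolding delta_covering_def by (meson order.trans)
qed

text \<open>The Lipschitz constants of the inverse are only local. By Lindelof, countably many balls
  \<open>B\<close> suffice, each with a single constant, and each is handled at times so late that
  no point of \<open>B\<close> is exempt from the constraint.\<close>

lemma hausdorff_null_preimage_layer:
  fixes \<psi> :: "'a \<Rightarrow> 'a"
  assumes inj: "inj_on \<psi> \<Omega>" and lip: "locally_bilipschitz_on (\<psi> ` \<Omega>) (inv_into \<Omega> \<psi>)"
  shows "hausdorff_null h (thicken {z \<in> \<Omega>. \<psi> z \<in> layer i})"
proof -
  define \<F> where "\<F> = {ball y \<epsilon> | y \<epsilon>. y \<in> \<psi> ` \<Omega> \<and> \<epsilon> > 0 \<and>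
      (\<exists>c1 c2. bilipschitz_on c1 c2 (ball y \<epsilon> \<inter> \<psi> ` \<Omega>) (inv_into \<Omega> \<psi>))}"
  obtain \<F>' where \<F>': "\<F>' \<subseteq> \<F>" "countable \<F>'" "\<Union>\<F>' = \<Union>\<F>"
    by (rule Lindelof[of \<F>]) (auto simp: \<F>_def)
  have "\<psi> ` \<Omega> \<subseteq> \<Union>\<F>"
  proof
    fix y assume y: "y \<in> \<psi> ` \<Omega>"
    then obtain \<epsilon> c1 c2 where \<epsilon>: "\<epsilon> > 0"
      and "bilipschitz_on c1 c2 (ball y \<epsilon> \<inter> \<psi> ` \<Omega>) (inv_into \<Omega> \<psi>)"
      using lip unfolding locally_bilipschitz_on_def by meson
    with y have "ball y \<epsilon> \<in> \<F>"
      unfolding \<F>_def by blast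
    then show "y \<in> \<Union>\<F>"
      using \<epsilon> by (intro UnionI[of "ball y \<epsilon>"]) simp_all
  qed
  then have split: "{z \<in> \<Omega>. \<psi> z \<in> layer i} = (\<Union>B\<in>\<F>'. {z \<in> \<Omega>. \<psi> z \<in> layer i \<inter> B})"
    using \<F>'(3) by blast
  have "hausdorff_null h (thicken {z \<in> \<Omega>. \<psi> z \<in> layer i \<inter> B})" if B: "B \<in> \<F>'" for B
  proof -
    obtain L where L: "bounded B" "L > 0"
      "\<And>y z. y \<in> \<Omega> \<Longrightarrow> z \<in> \<Omega> \<Longrightarrow> \<psi> y \<in> B \<Longrightarrow> \<psi> z \<in> B \<Longrightarrow> dist y z \<le> L * dist (\<psi> y) (\<psi> z)"
    proof -
      obtain y0 \<epsilon> c1 c2 where B_eq: "B = ball y0 \<epsilon>"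
        and bl: "bilipschitz_on c1 c2 (ball y0 \<epsilon> \<inter> \<psi> ` \<Omega>) (inv_into \<Omega> \<psi>)"
        using B \<F>'(1) unfolding \<F>_def by blast
      have "dist y z \<le> c2 * dist (\<psi> y) (\<psi> z)"
        if "y \<in> \<Omega>" "z \<in> \<Omega>" "\<psi> y \<in> B" "\<psi> z \<in> B" for y z
      proof -
        have "\<psi> y \<in> ball y0 \<epsilon> \<inter> \<psi> ` \<Omega>" "\<psi> z \<in> ball y0 \<epsilon> \<inter> \<psi> ` \<Omega>"
          using that by (auto simp: B_eq)
        then have "dist (inv_into \<Omega> \<psi> (\<psi> y)) (inv_into \<Omega> \<psi> (\<psi> z)) \<le> c2 * dist (\<psi> y) (\<psi> z)"
          using bl unfolding bilipschitz_on_def by blast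
        then show ?thesis
          using that inj by simp
      qed
      moreover have "bounded B" "c2 > 0"
        using bl by (auto simp: B_eq bilipschitz_on_def)
      ultimately show thesis
        by (intro that[of c2])
    qed
    obtain R where R: "\<And>y. y \<in> B \<Longrightarrow> norm y \<le> R"
      using L(1) bounded_iff by blast
    show ?thesis
    proof (rule hausdorff_null_thicken[where L = "2 * L"])
      fix m
      obtain k where k: "max R (real m) < real k"
        using reals_Archimedean2 by blast
      \<comment> \<open>A time of class \<open>i\<close> beyond both \<open>m\<close> and the radius
        \<open>R\<close>, because a pair code dominates \<open>k\<close>.\<close>
      define t where "t = prod_encode (i, k)"
      then have t_class: "fst (prod_decode t) = i"
        by simp
      have "k \<le> t"
        unfolding t_def by (rule le_prod_encode_2)
      then have t: "m \<le> t" "R < real t"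
        using k by auto
      define V where "V p = {z \<in> \<Omega>. \<psi> z \<in> B \<and> dist p (\<psi> z) \<le> \<delta> t}" for p
      have "{z \<in> \<Omega>. \<psi> z \<in> layer i \<inter> B} \<subseteq> (\<Union>p\<in>P t. V p)"
      proof safe
        fix z assume z: "z \<in> \<Omega>" "\<psi> z \<in> layer i" "\<psi> z \<in> B"
        then have "\<not> real t \<le> norm (\<psi> z)"
          using R t(2) by fastforce
        then obtain p where "p \<in> P t" "dist p (\<psi> z) \<le> \<delta> t"
          using z(2) t_class unfolding layer_def by blast
        then show "z \<in> (\<Union>p\<in>P t. V p)"
          using z by (auto simp: V_def)
      qed
      moreover have "dist y z \<le> 2 * L * \<delta> t" if "y \<in> V p" "z \<in> V p" for p y z
      proof -
        have "dist y z \<le> L * dist (\<psi> y) (\<psi> z)"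
          using that L(3) by (auto simp: V_def)
        also have "\<dots> \<le> L * (2 * \<delta> t)"
          using that L(2) dist_triangle3[of "\<psi> y" "\<psi> z" p] by (intro mult_left_mono) (auto simp: V_def)
        finally show ?thesis by simp
      qed
      ultimately show "\<exists>t\<ge>m. \<exists>V. {z \<in> \<Omega>. \<psi> z \<in> layer i \<inter> B} \<subseteq> (\<Union>p\<in>P t. V p) \<and>
          (\<forall>p\<in>P t. \<forall>y\<in>V p. \<forall>z\<in>V p. dist y z \<le> 2 * L * \<delta> t)"
        using t(1) by blast
    qed
  qed
  then show ?thesis
    unfolding split thicken_UN by (intro hausdorff_null_UN[OF h \<F>'(2)])
qed

end

section \<open>Existence of suitable scales and nets\<close>

lemma exists_scale:
  assumes h: "dimension_function h" and b: "b > 0"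
  shows "\<exists>\<delta>>0. \<delta> \<le> b \<and> 2 * (real t + 1) * \<delta> \<le> 1 / (real t + 1) \<and>
    ereal (real K) * h (2 * (real t + 1) * \<delta>) \<le> ereal (1 / (real t + 1))"
proof -
  \<comment> \<open>The denominator uses \<open>K + 1\<close> so that \<open>K = 0\<close> is
    allowed.\<close>
  define e where "e = 1 / ((real t + 1) * (real K + 1))"
  have "e > 0" by (simp add: e_def)
  then obtain d where d: "d > 0" "\<And>s. 0 \<le> s \<Longrightarrow> s \<le> d \<Longrightarrow> h s \<le> ereal e"
    using dimension_function_small[OF h] by blast
  define \<rho> where "\<rho> = min (2 * (real t + 1) * b) (min d (1 / (real t + 1)))"
  define \<delta> where "\<delta> = \<rho> / (2 * (real t + 1))"
  have \<rho>: "\<rho> > 0" "\<rho> \<le> d" "\<rho> \<le> 1 / (real t + 1)" "\<rho> \<le> 2 * (real t + 1) * b"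
    using b d(1) by (auto simp: \<rho>_def)
  have eq: "2 * (real t + 1) * \<delta> = \<rho>"
    by (simp add: \<delta>_def)
  have "ereal (real K) * h \<rho> \<le> ereal (real K) * ereal e"
    using d(2)[of \<rho>] \<rho> by (intro ereal_mult_left_mono) auto
  also have "\<dots> \<le> ereal ((real K + 1) * e)"
    using \<open>e > 0\<close> by simp
  also have "\<dots> = ereal (1 / (real t + 1))"
    by (simp add: e_def)
  finally have "ereal (real K) * h \<rho> \<le> ereal (1 / (real t + 1))" .
  moreover have "\<delta> > 0" "\<delta> \<le> b"
    using \<rho> by (auto simp: \<delta>_def field_simps)
  ultimately show ?thesis
    using \<rho>(3) unfolding eq[symmetric] by blast
qed

lemma exists_finite_net:
  assumes "\<eta> > 0"
  obtains Q :: "'a::euclidean_space set" where "finite Q" "\<And>y. norm y \<le> R \<Longrightarrow> \<exists>p\<in>Q. dist y p < \<eta>"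
proof -
  have "compact (cball (0::'a) R)" by simp
  then obtain Q where "finite Q" "cball (0::'a) R \<subseteq> (\<Union>p\<in>Q. ball p \<eta>)"
    using assms unfolding compact_eq_totally_bounded by blast
  then show thesis
    by (intro that[of Q]) (fastforce simp: dist_commute)+
qed

text \<open>Dependent choice in alternating order: the old scale fixes the mesh of the next net, and
  only then, with the size of that net known, is the next scale chosen. At time 0 the empty net is
  enough, since \<open>net\<close> speaks of \<open>P (Suc t)\<close> only.\<close>

lemma exists_covering_scales:
  assumes h: "dimension_function h"
  shows "\<exists>(P :: nat \<Rightarrow> 'a::euclidean_space set) \<delta>. covering_scales h P \<delta>"
proof -
  define good where "good t x \<longleftrightarrow> finite (fst x) \<and> 0 < snd x \<and> snd x \<le> 1 \<and>
      2 * (real t + 1) * snd x \<le> 1 / (real t + 1) \<and>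
      ereal (real (card (fst x) * 2 ^ t)) * h (2 * (real t + 1) * snd x) \<le> ereal (1 / (real t + 1))"
    for t and x :: "'a set \<times> real"
  define nxt where "nxt t x y \<longleftrightarrow> snd y \<le> snd x / 2 \<and>
      (\<forall>z. norm z \<le> real t + 2 \<longrightarrow> (\<exists>p\<in>fst y. dist z p < snd x / (2 * (real t + 2))))"
    for t and x y :: "'a set \<times> real"
  have "\<exists>f. \<forall>t. good t (f t) \<and> nxt t (f t) (f (Suc t))"
  proof (rule dependent_nat_choice)
    obtain \<delta> where "\<delta> > 0" "\<delta> \<le> 1" "2 * (real 0 + 1) * \<delta> \<le> 1 / (real 0 + 1)"
      "ereal (real 0) * h (2 * (real 0 + 1) * \<delta>) \<le> ereal (1 / (real 0 + 1))"
      using exists_scale[OF h, of 1 0 0] by auto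
    then show "\<exists>x. good 0 x"
      by (intro exI[of _ "({}, \<delta>)"]) (simp add: good_def)
  next
    fix x t assume x: "good t x"
    then have "snd x / (2 * (real t + 2)) > 0"
      by (simp add: good_def)
    then obtain Q :: "'a set" where Q: "finite Q"
      "\<And>y. norm y \<le> real t + 2 \<Longrightarrow> \<exists>p\<in>Q. dist y p < snd x / (2 * (real t + 2))"
      using exists_finite_net by blast
    obtain \<delta> where "\<delta> > 0" "\<delta> \<le> snd x / 2" "2 * (real (Suc t) + 1) * \<delta> \<le> 1 / (real (Suc t) + 1)"
      "ereal (real (card Q * 2 ^ Suc t)) * h (2 * (real (Suc t) + 1) * \<delta>) \<le> ereal (1 / (real (Suc t) + 1))"
      using exists_scale[OF h, of "snd x / 2" "Suc t" "card Q * 2 ^ Suc t"] x unfolding good_def by auto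
    then show "\<exists>y. good (Suc t) y \<and> nxt t x y"
      using Q x unfolding good_def nxt_def by (intro exI[of _ "(Q, \<delta>)"]) auto
  qed
  then obtain f where f: "\<And>t. good t (f t)" "\<And>t. nxt t (f t) (f (Suc t))"
    by blast
  have "covering_scales h (\<lambda>t. fst (f t)) (\<lambda>t. snd (f t))"
    using h f unfolding covering_scales_def good_def nxt_def by blast
  then show ?thesis by blast
qed

section \<open>Assembling the set and finding the common point\<close>

theorem theorem3p7:
  fixes h :: "real \<Rightarrow> ereal"
    and F :: "(real ^ 'n \<Rightarrow> real ^ 'n) set"
    and J :: "'j set"
    and \<Omega> :: "'j \<Rightarrow> (real ^ 'n) set"
    and \<psi> :: "'j \<Rightarrow> real ^ 'n \<Rightarrow> real ^ 'n"
    and r :: "(real ^ 'n \<Rightarrow> real ^ 'n) \<Rightarrow> 'j"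
    and D :: "(real ^ 'n \<Rightarrow> real ^ 'n) \<Rightarrow> (real ^ 'n) set"
  assumes "dimension_function h"
    and "\<And>f. f \<in> F \<Longrightarrow> continuous_on UNIV f"
    and "countable J"
    and "\<And>j. j \<in> J \<Longrightarrow> closed (\<Omega> j)"
    and "\<And>j. j \<in> J \<Longrightarrow> inj_on (\<psi> j) (\<Omega> j)"
    and "\<And>j. j \<in> J \<Longrightarrow> closed_map (top_of_set (\<Omega> j)) euclidean (\<psi> j)"
    and "\<And>j. j \<in> J \<Longrightarrow> continuous_on (\<Omega> j) (\<psi> j)"
    and "\<And>j. j \<in> J \<Longrightarrow> locally_bilipschitz_on (\<psi> j ` \<Omega> j) (inv_into (\<Omega> j) (\<psi> j))"
    and "\<And>j. j \<in> J \<Longrightarrow>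
           filterlim (\<lambda>x. norm (inv_into (\<Omega> j) (\<psi> j) x)) at_top
             (inf at_infinity (principal (\<psi> j ` \<Omega> j)))"
    and "\<And>f. f \<in> F \<Longrightarrow> r f \<in> J"
    and "\<And>f. f \<in> F \<Longrightarrow> closed (D f)"
    and "\<And>f. f \<in> F \<Longrightarrow> f ` D f \<subseteq> \<Omega> (r f)"
    and "\<And>f. f \<in> F \<Longrightarrow> nonexpansive_bilipschitz_on (D f) (\<psi> (r f) \<circ> f)"
    and "\<And>a G. a > 0 \<Longrightarrow> finite G \<Longrightarrow> G \<subseteq> F \<Longrightarrow>
           contains_arbitrarily_large_balls
             (\<Inter>f\<in>G. {x \<in> D f. (\<psi> (r f) \<circ> f) x \<in> {y. \<forall>i. y $ i \<in> - {-a<..<a :: real}}})"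
  shows "\<exists>E :: (real ^ 'n) set. perfect_set E \<and> hausdorff_measure h E = 0 \<and>
           (\<forall>G. finite G \<and> G \<subseteq> F \<longrightarrow> (\<Inter>f\<in>G. f -` E) \<noteq> {})"
proof -
  note J = assms(3) and \<Omega>_closed = assms(4) and inj = assms(5) and cont = assms(7)
    and loc_bil = assms(8) and lim = assms(9) and r = assms(10) and D_\<Omega> = assms(12)
    and nonexp = assms(13) and balls = assms(14)
  obtain P :: "nat \<Rightarrow> (real ^ 'n) set" and \<delta> where "covering_scales h P \<delta>"
    using exists_covering_scales[OF assms(1)] by blast
  then interpret covering_scales h P \<delta> .
  \<comment> \<open>The number \<open>n\<close> encodes an index of \<open>J\<close> together with a
    layer, and is also the cut-off radius, which makes the union locally finite. The inner union has
    at most one member.\<close>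
  define A where "A n = (\<Union>j \<in> {j \<in> J. to_nat_on J j = fst (prod_decode n)}.
      {z \<in> \<Omega> j. \<psi> j z \<in> layer (snd (prod_decode n))} \<inter> {z. real n \<le> norm z})" for n
  define E where "E = thicken (\<Union>n. A n)"
  have single: "finite {j \<in> J. to_nat_on J j = a}" for a
    by (rule finite_subset[of _ "{from_nat_into J a}"]) (auto simp: J)
  have "closed (\<Union>n. A n)"
  proof (rule closed_UN_escaping)
    fix n
    have "closed {z \<in> \<Omega> j. \<psi> j z \<in> layer i}" if "j \<in> J" for i j
      using continuous_closed_preimage[OF cont[OF that] \<Omega>_closed[OF that] closed_layer[of i]]
      by (simp add: vimage_def Int_def)
    moreover have "closed {z::real ^ 'n. real n \<le> norm z}"
      by (intro closed_Collect_le continuous_intros)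
    ultimately show "closed (A n)"
      unfolding A_def using single by (intro closed_UN closed_Int) auto
  qed (auto simp: A_def)
  then have "perfect_set E"
    unfolding E_def by (rule perfect_thicken)
  moreover have "hausdorff_measure h E = 0"
  proof (rule hausdorff_measure_null[OF h])
    have "hausdorff_null h (thicken (A n))" for n
    proof -
      define B where "B = (\<Union>j\<in>J. {z \<in> \<Omega> j. \<psi> j z \<in> layer (snd (prod_decode n))})"
      have "hausdorff_null h (thicken B)"
        unfolding B_def thicken_UN
        by (intro hausdorff_null_UN[OF h J] hausdorff_null_preimage_layer inj loc_bil)
      moreover have "A n \<subseteq> B"
        by (auto simp: A_def B_def)
      then have "thicken (A n) \<subseteq> thicken B"
        unfolding thicken_def by blast
      ultimately show ?thesis
        by (rule hausdorff_null_mono)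
    qed
    then show "hausdorff_null h E"
      unfolding E_def thicken_UN by (intro hausdorff_null_UN_nat[OF h])
  qed
  moreover have "(\<Inter>f\<in>G. f -` E) \<noteq> {}" if G: "finite G" "G \<subseteq> F" for G
  proof -
    define g where "g f = \<psi> (r f) \<circ> f" for f
    \<comment> \<open>Finitely many maps share the constants \<open>1 / (real t + 2)\<close> and 1
      once \<open>t\<close> is large.\<close>
    have "\<forall>\<^sub>F t in sequentially. \<forall>f\<in>G. bilipschitz_on (1 / (real t + 2)) 1 (D f) (g f)"
    proof (intro eventually_ball_finite[OF G(1)] ballI)
      fix f assume "f \<in> G"
      then obtain c1 c2 where c: "bilipschitz_on c1 c2 (D f) (g f)" "c2 \<le> 1"
        using nonexp G(2) unfolding nonexpansive_bilipschitz_on_def g_def by blast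
      then have "c1 > 0"
        by (simp add: bilipschitz_on_def)
      have "\<forall>\<^sub>F t in sequentially. 1 / c1 < real t"
        using filterlim_real_sequentially unfolding filterlim_at_top_dense by blast
      then show "\<forall>\<^sub>F t in sequentially. bilipschitz_on (1 / (real t + 2)) 1 (D f) (g f)"
      proof eventually_elim
        case (elim t)
        show ?case
          unfolding bilipschitz_on_def
        proof (intro conjI ballI)
          fix x y assume xy: "x \<in> D f" "y \<in> D f"
          have "1 / (real t + 2) * dist x y \<le> c1 * dist x y"
            using elim \<open>c1 > 0\<close> by (intro mult_right_mono) (auto simp: field_simps add_increasing2)
          also have "\<dots> \<le> dist (g f x) (g f y)"
            using c(1) xy by (simp add: bilipschitz_on_def)
          finally show "1 / (real t + 2) * dist x y \<le> dist (g f x) (g f y)" .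
          have "dist (g f x) (g f y) \<le> c2 * dist x y"
            using c(1) xy by (simp add: bilipschitz_on_def)
          also have "\<dots> \<le> 1 * dist x y"
            using c(2) by (intro mult_right_mono) auto
          finally show "dist (g f x) (g f y) \<le> 1 * dist x y" .
        qed auto
      qed
    qed
    from eventually_happens'[OF sequentially_bot this]
    obtain t0 where t0: "\<And>f. f \<in> G \<Longrightarrow> bilipschitz_on (1 / (real t0 + 2)) 1 (D f) (g f)"
      by blast
    define idx where "idx f = Suc (t0 + to_nat_on G f)" for f
    define code where "code f = prod_encode (to_nat_on J (r f), idx f)" for f
    \<comment> \<open>The growth of the inverses at infinity turns a large value of
      \<open>g f\<close> into a large value of \<open>f\<close>, past the cut-off radius
      \<open>code f\<close>.\<close>
    have "\<forall>\<^sub>F a in at_top. \<forall>f\<in>G. \<forall>y\<in>\<Omega> (r f). a \<le> norm (\<psi> (r f) y) \<longrightarrow>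
        real (code f) \<le> norm y"
    proof (intro eventually_ball_finite[OF G(1)] ballI)
      fix f assume "f \<in> G"
      then have rf: "r f \<in> J" using G(2) r by blast
      then have "\<forall>\<^sub>F y in inf at_infinity (principal (\<psi> (r f) ` \<Omega> (r f))).
          real (code f) \<le> norm (inv_into (\<Omega> (r f)) (\<psi> (r f)) y)"
        using lim unfolding filterlim_at_top by blast
      then obtain b where "\<forall>y\<in>\<psi> (r f) ` \<Omega> (r f). b \<le> norm y \<longrightarrow>
          real (code f) \<le> norm (inv_into (\<Omega> (r f)) (\<psi> (r f)) y)"
        unfolding eventually_inf_principal eventually_at_infinity by blast
      then have "\<forall>y\<in>\<Omega> (r f). b \<le> norm (\<psi> (r f) y) \<longrightarrow> real (code f) \<le> norm y"
        using inj[OF rf] by simp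
      then show "\<forall>\<^sub>F a in at_top. \<forall>y\<in>\<Omega> (r f). a \<le> norm (\<psi> (r f) y) \<longrightarrow>
          real (code f) \<le> norm y"
        unfolding eventually_at_top_linorder by (meson order.trans)
    qed
    then have "\<forall>\<^sub>F a in at_top. 0 < a \<and> (\<forall>f\<in>G. \<forall>y\<in>\<Omega> (r f). a \<le> norm (\<psi> (r f) y) \<longrightarrow>
        real (code f) \<le> norm y)"
      by (intro eventually_conj eventually_gt_at_top)
    from eventually_happens'[OF trivial_limit_at_top_linorder this]
    obtain a where a: "a > 0" "\<And>f y. f \<in> G \<Longrightarrow> y \<in> \<Omega> (r f) \<Longrightarrow> a \<le> norm (\<psi> (r f) y) \<Longrightarrow>
        real (code f) \<le> norm y"
      by blast
    \<comment> \<open>Radius 2 leaves the closed unit ball inside.\<close>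
    obtain x0 where x0: "ball x0 2 \<subseteq>
        (\<Inter>f\<in>G. {x \<in> D f. (\<psi> (r f) \<circ> f) x \<in> {y. \<forall>i. y $ i \<in> - {-a<..<a}}})"
      using balls[OF a(1) G] unfolding contains_arbitrarily_large_balls_def
      by (meson zero_less_numeral)
    have in_D: "z \<in> D f" and big: "a \<le> norm (g f z)" if "f \<in> G" "z \<in> cball x0 1" for f z
    proof -
      have "z \<in> ball x0 2" using that(2) by simp
      with x0 that(1) have z: "z \<in> {x \<in> D f. (\<psi> (r f) \<circ> f) x \<in> {y. \<forall>i. y $ i \<in> - {-a<..<a}}}"
        by blast
      then show "z \<in> D f" by simp
      \<comment> \<open>Any single coordinate of absolute value at least \<open>a\<close> bounds the
        norm from below; \<open>undefined\<close> serves as an arbitrary index.\<close>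
      have "g f z $ undefined \<in> - {-a<..<a}"
        using z by (simp add: g_def)
      then have "a \<le> \<bar>g f z $ undefined\<bar>"
        by (auto simp: abs_if)
      then show "a \<le> norm (g f z)"
        using component_le_norm_cart by (rule order.trans)
    qed
    have "\<exists>x\<in>cball x0 1. \<forall>f\<in>G. g f x \<in> layer (idx f)"
    proof (rule common_point_in_layers)
      show "inj_on idx G"
        using inj_on_to_nat_on[OF countable_finite[OF G(1)]] by (auto simp: idx_def inj_on_def)
      show "bilipschitz_on (1 / (real t0 + 2)) 1 (cball x0 1) (g f)" if "f \<in> G" for f
        using t0[OF that] in_D[OF that] unfolding bilipschitz_on_def by blast
    qed (simp add: idx_def)
    then obtain x where x: "x \<in> cball x0 1" "\<And>f. f \<in> G \<Longrightarrow> g f x \<in> layer (idx f)"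
      by blast
    have "f x \<in> E" if f: "f \<in> G" for f
    proof -
      have "f x \<in> \<Omega> (r f)"
        using D_\<Omega> in_D[OF f x(1)] f G(2) by blast
      moreover from this have "real (code f) \<le> norm (f x)"
        using a(2)[OF f] big[OF f x(1)] by (simp add: g_def)
      ultimately have "f x \<in> A (code f)"
        using x(2)[OF f] r f G(2) by (auto simp: A_def code_def g_def)
      then show ?thesis
        unfolding E_def using subset_thicken by blast
    qed
    then show ?thesis by blast
  qed
  ultimately show ?thesis by blast
qed

end
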